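(* For $r\ge 2$ and $n\ge r$, \[V_n^{(r)}(x,y)=x\sum_{i=1}^{r-1}(n-1)_{i-1}\,V_{n-i}^{(r)}(x,y)+(y+n-r)(n-1)_{r-1}\,V_{n-r}^{(r)}(x,y),\] where $V_n^{(r)}(x,y)=x^{(n)}$ for $0\le n\le r-1$.
   Context: Fix an integer $r\ge 2$ and indeterminates $x,y$. For $n\ge 1$ let $A_n^{(r)}(x,y)=(a_{i,j})_{1\le i,j\le n}$ be the $n\times n$ matrix with $a_{i,i+1}=-i$ for $1\le i\le n-1$; $a_{i,j}=x$ whenever $0\le i-j\le r-2$; $a_{i,i-r+1}=y+i-r$ for $r\le i\le n$; and all other entries $0$. Define $V_0^{(r)}(x,y)=1$ and $V_n^{(r)}(x,y)=\det A_n^{(r)}(x,y)$ for $n\ge 1$. Notation: $(m)_0=1$, $(m)_k=m(m-1)\cdots(m-k+1)$ (falling factorial); $x^{(0)}=1$, $x^{(n)}=x(x+1)\cdots(x+n-1)$ (rising factorial). *)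

theory Defs
  imports "Jordan_Normal_Form.Determinant"
begin

text \<open>
  The pair \<open>x, y\<close> ranges over an arbitrary commutative ring; the case of two indeterminates is
  the instance \<open>'a = int poly poly\<close>, \<open>x = [:[:0, 1:]:]\<close>, \<open>y = [:0, 1:]\<close>.
\<close>

definition falling_factorial :: "'a::comm_ring_1 \<Rightarrow> nat \<Rightarrow> 'a" where
  "falling_factorial m k = (\<Prod>i<k. m - of_nat i)"

text \<open>
  Entries are indexed from 1. For \<open>r \<ge> 2\<close> the side conditions are \<open>0 \<le> i - j \<le> r - 2\<close> and
  \<open>j = i - r + 1\<close>, written without truncated subtraction.
\<close>

definition A_entry :: "nat \<Rightarrow> 'a::comm_ring_1 \<Rightarrow> 'a \<Rightarrow> nat \<Rightarrow> nat \<Rightarrow> 'a" where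
  "A_entry r x y i j =
     (if j = i + 1 then - of_nat i
      else if j \<le> i \<and> i + 2 \<le> j + r then x
      else if j + r = i + 1 then y + of_nat i - of_nat r
      else 0)"

text \<open>Library matrices are indexed from 0, hence the shift.\<close>

definition A_mat :: "nat \<Rightarrow> nat \<Rightarrow> 'a::comm_ring_1 \<Rightarrow> 'a \<Rightarrow> 'a mat" where
  "A_mat r n x y = mat n n (\<lambda>(i, j). A_entry r x y (i + 1) (j + 1))"

definition V :: "nat \<Rightarrow> nat \<Rightarrow> 'a::comm_ring_1 \<Rightarrow> 'a \<Rightarrow> 'a" where
  "V r n x y = (if n = 0 then 1 else det (A_mat r n x y))"

end

theory Submission
  imports Defs
begin

text \<open>
  Expanding a lower Hessenberg determinant along its last row gives a recurrence over all leading
  principal minors, weighted by products of negated superdiagonal entries. For the matrix at hand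
  these products are falling factorials and only the last \<open>r\<close> entries of the row are nonzero.
  Below order \<open>r\<close> the recurrence telescopes to \<open>V (n + 1) = (x + n) * V n\<close>.
\<close>

text \<open>
  The last row is kept arbitrary: expanding along the last column replaces the leading Hessenberg
  part by a smaller one but leaves the same row at the bottom, which makes the induction work.
\<close>

lemma det_hessenberg_last_row:
  fixes a :: "nat \<Rightarrow> nat \<Rightarrow> 'a::comm_ring_1"
  assumes "\<And>i j. Suc i < j \<Longrightarrow> a i j = 0"
  shows "det (mat (Suc n) (Suc n) (\<lambda>(i, j). if i = n then b j else a i j)) =
    (\<Sum>k\<le>n. b k * (\<Prod>m = k..<n. - a m (Suc m)) * det (mat k k (\<lambda>(i, j). a i j)))"
proof (induction n)
  case 0
  show ?case by (simp add: det_single)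
next
  case (Suc n)
  define M where "M = mat (Suc (Suc n)) (Suc (Suc n)) (\<lambda>(i, j). if i = Suc n then b j else a i j)"
  have M: "M \<in> carrier_mat (Suc (Suc n)) (Suc (Suc n))"
    by (simp add: M_def)
  \<comment> \<open>Only rows \<open>n\<close> and \<open>Suc n\<close> survive in the last column:
    any earlier row meets it strictly above the superdiagonal.\<close>
  have zero: "M $$ (i, Suc n) = 0" if "i < n" for i
    using that assms by (simp add: M_def)
  have upper: "mat_delete M (Suc n) (Suc n) = mat (Suc n) (Suc n) (\<lambda>(i, j). a i j)"
    by (rule eq_matI) (auto simp: M_def mat_delete_def)
  \<comment> \<open>Deleting row \<open>n\<close> moves \<open>b\<close> up into its place, so the
    minor is exactly the matrix of the induction hypothesis.\<close>
  have lower: "mat_delete M n (Suc n) =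
      mat (Suc n) (Suc n) (\<lambda>(i, j). if i = n then b j else a i j)"
    by (rule eq_matI) (auto simp: M_def mat_delete_def)
  have "det M = (\<Sum>i<Suc (Suc n). M $$ (i, Suc n) * cofactor M i (Suc n))"
    by (rule laplace_expansion_column[OF M]) simp
  also have "\<dots> = a n (Suc n) * cofactor M n (Suc n) + b (Suc n) * cofactor M (Suc n) (Suc n)"
    using zero by (simp add: M_def)
  also have "\<dots> = - a n (Suc n) * det (mat_delete M n (Suc n))
      + b (Suc n) * det (mat_delete M (Suc n) (Suc n))"
    by (simp add: cofactor_def)
  \<comment> \<open>The factor \<open>- a n (Suc n)\<close>, its sign coming from the odd cofactor
    position, extends each product by \<open>m = n\<close>. The other cofactor is the new summand
    \<open>k = Suc n\<close>, with empty product.\<close>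
  also have "- a n (Suc n) * det (mat_delete M n (Suc n)) =
      (\<Sum>k\<le>n. b k * (\<Prod>m = k..<Suc n. - a m (Suc m)) * det (mat k k (\<lambda>(i, j). a i j)))"
    unfolding lower Suc.IH sum_distrib_left
    by (rule sum.cong) (simp_all add: algebra_simps)
  finally show ?case
    by (simp add: M_def[symmetric] upper)
qed

lemma det_hessenberg:
  fixes a :: "nat \<Rightarrow> nat \<Rightarrow> 'a::comm_ring_1"
  assumes "\<And>i j. Suc i < j \<Longrightarrow> a i j = 0"
  shows "det (mat (Suc n) (Suc n) (\<lambda>(i, j). a i j)) =
    (\<Sum>k\<le>n. a n k * (\<Prod>m = k..<n. - a m (Suc m)) * det (mat k k (\<lambda>(i, j). a i j)))"
proof -
  have "mat (Suc n) (Suc n) (\<lambda>(i, j). a i j) =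
      mat (Suc n) (Suc n) (\<lambda>(i, j). if i = n then a n j else a i j)"
    by (rule eq_matI) auto
  then show ?thesis
    using det_hessenberg_last_row[of a n "a n"] assms by simp
qed

lemma falling_factorial_0 [simp]: "falling_factorial m 0 = 1"
  by (simp add: falling_factorial_def)

lemma falling_factorial_Suc: "falling_factorial m (Suc k) = m * falling_factorial (m - 1) k"
  unfolding falling_factorial_def
  by (subst prod.lessThan_Suc_shift) (simp add: algebra_simps)

text \<open>Both sides multiply the \<open>i\<close> numbers from \<open>n\<close> downwards;
  \<open>i \<le> n\<close> keeps the subtraction \<open>n - i\<close> from truncating.\<close>

lemma prod_of_nat_eq_falling_factorial:
  "i \<le> n \<Longrightarrow> (\<Prod>m = n - i..<n. of_nat (Suc m)) = falling_factorial (of_nat n) i"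
proof (induction i arbitrary: n)
  case 0
  show ?case by simp
next
  case (Suc i)
  then obtain p where n: "n = Suc p" and p: "i \<le> p"
    by (cases n) auto
  have "(\<Prod>m = n - Suc i..<n. of_nat (Suc m)) =
      of_nat n * (\<Prod>m = p - i..<p. of_nat (Suc m) :: 'a)"
    using p by (simp add: n mult.commute)
  then show ?case
    using Suc.IH[OF p] by (simp add: falling_factorial_Suc n)
qed

lemma V_eq_det: "V r n x y = det (mat n n (\<lambda>(i, j). A_entry r x y (Suc i) (Suc j)))"
  by (simp add: V_def A_mat_def)

lemma V_0 [simp]: "V r 0 x y = 1"
  by (simp add: V_def)

text \<open>The negated superdiagonal entries are \<open>1, 2, ...\<close>, which turns the
  Hessenberg products into falling factorials. Summing over \<open>i = n - k\<close>, the distance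
  from the diagonal in the last row, matches the banded shape of the matrix.\<close>

lemma V_Suc:
  "V r (Suc n) x y = (\<Sum>i\<le>n. A_entry r x y (Suc n) (Suc (n - i)) *
     falling_factorial (of_nat n) i * V r (n - i) x y)"
proof -
  let ?a = "\<lambda>i j. A_entry r x y (Suc i) (Suc j)"
  have "V r (Suc n) x y =
      (\<Sum>k\<le>n. ?a n k * (\<Prod>m = k..<n. - ?a m (Suc m)) * V r k x y)"
    unfolding V_eq_det by (rule det_hessenberg) (simp add: A_entry_def)
  also have "\<dots> = (\<Sum>k\<le>n. ?a n k * (\<Prod>m = k..<n. of_nat (Suc m)) * V r k x y)"
    by (simp add: A_entry_def add.commute)
  also have "\<dots> = (\<Sum>i\<le>n. ?a n (n - i) * (\<Prod>m = n - i..<n. of_nat (Suc m)) * V r (n - i) x y)"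
    by (rule sum.nat_diff_reindex[symmetric, of _ "Suc n", unfolded lessThan_Suc_atMost, simplified])
  also have "\<dots> = (\<Sum>i\<le>n. ?a n (n - i) * falling_factorial (of_nat n) i * V r (n - i) x y)"
    by (rule sum.cong) (simp_all only: prod_of_nat_eq_falling_factorial atMost_iff)
  finally show ?thesis .
qed

text \<open>Here \<open>i \<le> n \<le> r - 2\<close>, so every entry of the last row lies in the
  band of \<open>x\<close>.\<close>

lemma V_Suc_small:
  assumes "Suc n < r"
  shows "V r (Suc n) x y = x * (\<Sum>i\<le>n. falling_factorial (of_nat n) i * V r (n - i) x y)"
  unfolding V_Suc sum_distrib_left
  by (rule sum.cong) (use assms in \<open>auto simp: A_entry_def mult.assoc\<close>)

lemma V_eq_pochhammer: "n < r \<Longrightarrow> V r n x y = pochhammer x n"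
proof (induction n)
  case 0
  show ?case by simp
next
  case (Suc n)
  have "V r (Suc n) x y = (x + of_nat n) * V r n x y"
  proof (cases n)
    case 0
    then show ?thesis using V_Suc_small[OF Suc.prems] by simp
  next
    case (Suc p)
    \<comment> \<open>After splitting off \<open>i = 0\<close>, each falling factorial of
      \<open>n\<close> releases a factor \<open>n\<close>, leaving the sum for the previous
      order.\<close>
    have "(\<Sum>i\<le>n. falling_factorial (of_nat n) i * V r (n - i) x y) =
        V r n x y + of_nat n * (\<Sum>i\<le>p. falling_factorial (of_nat p) i * V r (p - i) x y)"
      unfolding Suc sum.atMost_Suc_shift
      by (simp add: falling_factorial_Suc sum_distrib_left mult.assoc)
    then have "V r (Suc n) x y = x * V r n x y
        + of_nat n * (x * (\<Sum>i\<le>p. falling_factorial (of_nat p) i * V r (p - i) x y))"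
      by (simp add: V_Suc_small[OF Suc.prems] distrib_left mult.left_commute)
    \<comment> \<open>The same recurrence one order lower collapses the remaining sum to a single
      determinant.\<close>
    also have "x * (\<Sum>i\<le>p. falling_factorial (of_nat p) i * V r (p - i) x y) = V r n x y"
      using V_Suc_small[of p r x y] \<open>Suc n < r\<close> Suc by simp
    finally show ?thesis by (simp add: algebra_simps)
  qed
  then show ?case
    using Suc by (simp add: pochhammer_Suc mult.commute)
qed

lemma V_recurrence:
  fixes x y :: "'a::comm_ring_1"
  assumes "r \<ge> 2" "n \<ge> r"
  shows "V r n x y =
    x * (\<Sum>i = 1..r - 1. falling_factorial (of_nat (n - 1)) (i - 1) * V r (n - i) x y)
    + (y + of_nat n - of_nat r) * falling_factorial (of_nat (n - 1)) (r - 1) * V r (n - r) x y"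
proof -
  obtain p s where n: "n = Suc p" and r: "r = Suc s" and s: "1 \<le> s" "s \<le> p"
    using assms by (cases n; cases r) auto
  let ?f = "\<lambda>i. falling_factorial (of_nat p) i * V r (p - i) x y"
  let ?g = "\<lambda>i. A_entry r x y n (Suc (p - i)) * ?f i"
  have "V r n x y = (\<Sum>i\<le>p. ?g i)"
    unfolding n V_Suc by (simp add: mult.assoc)
  \<comment> \<open>Beyond distance \<open>s = r - 1\<close> from the diagonal the row vanishes;
    distance \<open>s\<close> itself carries the entry with \<open>y\<close>, smaller distances
    carry \<open>x\<close>.\<close>
  also have "\<dots> = (\<Sum>i\<le>s. ?g i)"
    by (rule sum.mono_neutral_right) (use s in \<open>auto simp: A_entry_def n r\<close>)
  also have "\<dots> = (\<Sum>i<s. ?g i) + ?g s"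
    by (simp add: lessThan_Suc_atMost[symmetric])
  also have "(\<Sum>i<s. ?g i) = x * (\<Sum>i<s. ?f i)"
    unfolding sum_distrib_left
    by (rule sum.cong) (use s in \<open>auto simp: A_entry_def n r\<close>)
  also have "(\<Sum>i<s. ?f i) = (\<Sum>i = 1..s. falling_factorial (of_nat p) (i - 1) * V r (n - i) x y)"
    by (rule sum.reindex_bij_witness[of _ "\<lambda>i. i - 1" Suc]) (auto simp: n)
  also have "?g s = (y + of_nat n - of_nat r) * ?f s"
    using s by (auto simp: A_entry_def n r)
  finally show ?thesis
    by (simp add: n r mult.assoc)
qed

theorem theorem2p2:
  fixes r :: nat and x y :: "'a::comm_ring_1"
  assumes "r \<ge> 2"
  shows "(\<forall>n\<ge>r. V r n x y =
            x * (\<Sum>i = 1..r - 1. falling_factorial (of_nat (n - 1)) (i - 1) * V r (n - i) x y)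
            + (y + of_nat n - of_nat r) * falling_factorial (of_nat (n - 1)) (r - 1) * V r (n - r) x y)
         \<and> (\<forall>n\<le>r - 1. V r n x y = pochhammer x n)"
  using V_recurrence[OF assms] V_eq_pochhammer[of _ r x y] assms by auto

end
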